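(* Let $\mathbf{d}$ be a distance on a set $X$. (1) If $\underline{\mathbf{d}_+}=\underline{\mathbf{d}}_+$, then $X$ is $\mathbf{d}^\bullet_\circ$-complete if and only if $X_+$ is $<^{\mathbf{d}_+}$-$\max$-complete. (2) $X$ is $\mathbf{d}^\bullet_\circ$-continuous if and only if $X_+$ is $<^{\mathbf{d}_+}$-$\max$-continuous and $\mathbf{0}\circ\mathbf{d}=\mathbf{0}$ (i.e. $\inf_{y\in X}y\mathbf{d}x=0$ for every $x\in X$).
   Context: Suprema and infima are taken in $[0,\infty]$, with $\sup\emptyset=0$, $\inf\emptyset=\infty$; for $a,b\in[0,\infty]$, $(a-b)_+=\min\{c\in[0,\infty]:a\leq b+c\}$; for real $r$, $r_+=\max(r,0)$, and $\infty_+=\infty$. A distance on $X$ is a function $\mathbf{d}:X\times X\to[0,\infty]$, written $x\mathbf{d}y$, with $x\mathbf{d}z\leq x\mathbf{d}y+y\mathbf{d}z$ for all $x,y,z$ (no symmetry, and $x\mathbf{d}x=0$ is not required). The lower hemimetric is $z\underline{\mathbf{d}}y=\sup_{x\in X}(x\mathbf{d}y-x\mathbf{d}z)_+$. $\mathbf{0}$ is the zero function. Formal balls: $X_+=X\times[0,\infty)$, and for any $\mathbf{d}:X\times X\to[0,\infty]$, $(x,r)\mathbf{d}_+(y,s)=(x\mathbf{d}y-r+s)_+$, which is a distance on $X_+$ if $\mathbf{d}$ is a distance on $X$. $\underline{\mathbf{d}_+}$ is the lower hemimetric of $\mathbf{d}_+$ on $X_+$, while $\underline{\mathbf{d}}_+=(\underline{\mathbf{d}})_+$.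 For any distance $\mathbf{d}$ on a set $X$, the strict order $<^{\mathbf{d}}$ is the (transitive) relation: $x<^{\mathbf{d}}y$ iff $\{z\in X:x\mathbf{d}z=0\}$ is a neighbourhood of $y$ in the topology generated by the balls $\{z:c\,\underline{\mathbf{d}}z<r\}$ ($c\in X$, $r>0$); equivalently, there is $\epsilon>0$ such that $y\underline{\mathbf{d}}z<\epsilon$ implies $x\mathbf{d}z=0$. $<^{\mathbf{d}_+}$ is this relation for $\mathbf{d}_+$ on $X_+$. For a transitive relation $<$ on a set $P$: $Y\subseteq P$ is $<$-directed if every finite $F\subseteq Y$ (including $\emptyset$) has some $y\in Y$ with $z<y$ for all $z\in F$; $x$ is a $<$-maximum of $Y$ if $y<x$ for all $y\in Y$ and every $z<x$ satisfies $z<y$ for some $y\in Y$. $P$ is $<$-$\max$-complete if every $<$-directed subset of $P$ has a $<$-maximum in $P$, and $<$-$\max$-continuous if every $x\in P$ is a $<$-maximum of some $<$-directed subset of $P$. A net is a family $(x_\lambda)_{\lambda\in\Lambda}$ indexed by a non-empty set with a transitive (not necessarily reflexive) relation $\prec$ such that any two elements $\gamma,\delta$ have some $\lambda$ with $\gamma,\delta\prec\lambda$; limits are taken along $\prec$. It is $\mathbf{d}$-Cauchy if $\lim_\gamma\sup_{\gamma\prec\delta}x_\gamma\mathbf{d}x_\delta=0$. The Smyth topology $\mathbf{d}^\bullet_\circ$ is generated by the sets $\{x:c\mathbf{d}x<r\}$ and $\{x:c\mathbf{d}x>r\}$ ($c\in X$, $r$ real). $X$ is $\mathbf{d}^\bullet_\circ$-complete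 if every $\mathbf{d}$-Cauchy net in $X$ has a $\mathbf{d}^\bullet_\circ$-limit in $X$, and $\mathbf{d}^\bullet_\circ$-continuous if every $x\in X$ is a $\mathbf{d}^\bullet_\circ$-limit of some $\mathbf{d}$-Cauchy net in $X$. *)

theory Defs
  imports "HOL-Analysis.Analysis"
begin

definition is_distance :: "'a set \<Rightarrow> ('a \<Rightarrow> 'a \<Rightarrow> ennreal) \<Rightarrow> bool" where
  "is_distance X d \<longleftrightarrow> (\<forall>x\<in>X. \<forall>y\<in>X. \<forall>z\<in>X. d x z \<le> d x y + d y z)"

text \<open>The function \<open>(a - b)\<^sub>+\<close> is not the subtraction of \<open>ennreal\<close>, where
  \<open>\<infinity> - \<infinity> = \<infinity>\<close>; here the value is \<open>0\<close> (see \<open>pos_diff_eq\<close>).\<close>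

definition pos_diff :: "ennreal \<Rightarrow> ennreal \<Rightarrow> ennreal" where
  "pos_diff a b = (LEAST c. a \<le> b + c)"

lemma pos_diff_eq: "pos_diff a b = (if b = top then 0 else a - b)"
  unfolding pos_diff_def
proof (rule Least_equality)
  show "a \<le> b + (if b = top then 0 else a - b)"
    using ennreal_minus_le_iff[of a b "a - b"] by simp
qed (auto simp: ennreal_minus_le_iff)

definition lower_hemimetric :: "'a set \<Rightarrow> ('a \<Rightarrow> 'a \<Rightarrow> ennreal) \<Rightarrow> 'a \<Rightarrow> 'a \<Rightarrow> ennreal" where
  "lower_hemimetric X d z y = (SUP x\<in>X. pos_diff (d x y) (d x z))"

definition formal_balls :: "'a set \<Rightarrow> ('a \<times> real) set" where
  "formal_balls X = X \<times> {0..}"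

text \<open>The map \<open>e2ennreal\<close> is the truncation \<open>r \<mapsto> r\<^sub>+\<close>: it sends negative values to \<open>0\<close>
  and \<open>\<infinity>\<close> to \<open>\<infinity>\<close>.\<close>

definition ball_dist :: "('a \<Rightarrow> 'a \<Rightarrow> ennreal) \<Rightarrow> 'a \<times> real \<Rightarrow> 'a \<times> real \<Rightarrow> ennreal" where
  "ball_dist d = (\<lambda>(x, r) (y, s). e2ennreal (enn2ereal (d x y) - ereal r + ereal s))"

definition hemiball_topology :: "'a set \<Rightarrow> ('a \<Rightarrow> 'a \<Rightarrow> ennreal) \<Rightarrow> 'a topology" where
  "hemiball_topology X d = topology_generated_by
     {{z \<in> X. lower_hemimetric X d c z < ennreal r} | c r. c \<in> X \<and> 0 < r}"

definition strict_order :: "'a set \<Rightarrow> ('a \<Rightarrow> 'a \<Rightarrow> ennreal) \<Rightarrow> 'a \<Rightarrow> 'a \<Rightarrow> bool" where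
  "strict_order X d x y \<longleftrightarrow> x \<in> X \<and> y \<in> X \<and>
     (\<exists>U. openin (hemiball_topology X d) U \<and> y \<in> U \<and> U \<subseteq> {z \<in> X. d x z = 0})"

definition directed_subset :: "'b set \<Rightarrow> ('b \<Rightarrow> 'b \<Rightarrow> bool) \<Rightarrow> 'b set \<Rightarrow> bool" where
  "directed_subset P lt Y \<longleftrightarrow>
     Y \<subseteq> P \<and> (\<forall>F. finite F \<and> F \<subseteq> Y \<longrightarrow> (\<exists>y\<in>Y. \<forall>z\<in>F. lt z y))"

definition is_maximum :: "'b set \<Rightarrow> ('b \<Rightarrow> 'b \<Rightarrow> bool) \<Rightarrow> 'b set \<Rightarrow> 'b \<Rightarrow> bool" where
  "is_maximum P lt Y x \<longleftrightarrow>
     x \<in> P \<and> (\<forall>y\<in>Y. lt y x) \<and> (\<forall>z\<in>P. lt z x \<longrightarrow> (\<exists>y\<in>Y. lt z y))"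

definition max_complete :: "'b set \<Rightarrow> ('b \<Rightarrow> 'b \<Rightarrow> bool) \<Rightarrow> bool" where
  "max_complete P lt \<longleftrightarrow> (\<forall>Y. directed_subset P lt Y \<longrightarrow> (\<exists>x\<in>P. is_maximum P lt Y x))"

definition max_continuous :: "'b set \<Rightarrow> ('b \<Rightarrow> 'b \<Rightarrow> bool) \<Rightarrow> bool" where
  "max_continuous P lt \<longleftrightarrow> (\<forall>x\<in>P. \<exists>Y. directed_subset P lt Y \<and> is_maximum P lt Y x)"

definition net_index :: "'i set \<Rightarrow> ('i \<Rightarrow> 'i \<Rightarrow> bool) \<Rightarrow> bool" where
  "net_index \<Lambda> prec \<longleftrightarrow> \<Lambda> \<noteq> {} \<and> transp_on \<Lambda> prec \<and>
     (\<forall>\<gamma>\<in>\<Lambda>. \<forall>\<delta>\<in>\<Lambda>. \<exists>\<mu>\<in>\<Lambda>. prec \<gamma> \<mu> \<and> prec \<delta> \<mu>)"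

definition net_filter :: "'i set \<Rightarrow> ('i \<Rightarrow> 'i \<Rightarrow> bool) \<Rightarrow> 'i filter" where
  "net_filter \<Lambda> prec = (INF \<gamma>\<in>\<Lambda>. principal {\<delta> \<in> \<Lambda>. prec \<gamma> \<delta>})"

definition Cauchy_net ::
  "'a set \<Rightarrow> ('a \<Rightarrow> 'a \<Rightarrow> ennreal) \<Rightarrow> 'i set \<Rightarrow> ('i \<Rightarrow> 'i \<Rightarrow> bool) \<Rightarrow> ('i \<Rightarrow> 'a) \<Rightarrow> bool" where
  "Cauchy_net X d \<Lambda> prec x \<longleftrightarrow> net_index \<Lambda> prec \<and> x ` \<Lambda> \<subseteq> X \<and>
     ((\<lambda>\<gamma>. SUP \<delta>\<in>{\<delta> \<in> \<Lambda>. prec \<gamma> \<delta>}. d (x \<gamma>) (x \<delta>)) \<longlongrightarrow> 0) (net_filter \<Lambda> prec)"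

text \<open>Distances are compared as extended reals because \<open>r\<close> may be negative.\<close>

definition smyth_topology :: "'a set \<Rightarrow> ('a \<Rightarrow> 'a \<Rightarrow> ennreal) \<Rightarrow> 'a topology" where
  "smyth_topology X d = topology_generated_by
     ({{x \<in> X. enn2ereal (d c x) < ereal r} | c r. c \<in> X} \<union>
      {{x \<in> X. enn2ereal (d c x) > ereal r} | c r. c \<in> X})"

text \<open>A definition cannot quantify over all index types.  The next two definitions use nets indexed
  by subsets of the type \<open>('a \<times> nat) set\<close>, with arbitrary relations.  This is no restriction
  if \<open>d\<close> is a distance: by \<open>smyth_complete_any_index\<close> completeness yields limits of Cauchy nets over
  every index type, and by \<open>smyth_continuous_any_index\<close> Cauchy nets over any index type suffice for
  continuity.\<close>

definition smyth_complete :: "'a set \<Rightarrow> ('a \<Rightarrow> 'a \<Rightarrow> ennreal) \<Rightarrow> bool" where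
  "smyth_complete X d \<longleftrightarrow>
     (\<forall>(\<Lambda> :: ('a \<times> nat) set set) prec x. Cauchy_net X d \<Lambda> prec x \<longrightarrow>
        (\<exists>l\<in>X. limitin (smyth_topology X d) x l (net_filter \<Lambda> prec)))"

definition smyth_continuous :: "'a set \<Rightarrow> ('a \<Rightarrow> 'a \<Rightarrow> ennreal) \<Rightarrow> bool" where
  "smyth_continuous X d \<longleftrightarrow>
     (\<forall>l\<in>X. \<exists>(\<Lambda> :: ('a \<times> nat) set set) prec x. Cauchy_net X d \<Lambda> prec x \<and>
        limitin (smyth_topology X d) x l (net_filter \<Lambda> prec))"

lemma eventually_net_filter:
  assumes "net_index \<Lambda> prec"
  shows "eventually P (net_filter \<Lambda> prec) \<longleftrightarrow> (\<exists>\<gamma>\<in>\<Lambda>. \<forall>\<delta>\<in>\<Lambda>. prec \<gamma> \<delta> \<longrightarrow> P \<delta>)"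
  unfolding net_filter_def
proof (subst eventually_INF_base)
  show "\<Lambda> \<noteq> {}" using assms by (auto simp: net_index_def)
next
  fix a b assume ab: "a \<in> \<Lambda>" "b \<in> \<Lambda>"
  then obtain m where m: "m \<in> \<Lambda>" "prec a m" "prec b m"
    using assms unfolding net_index_def by blast
  have "transp_on \<Lambda> prec" using assms by (simp add: net_index_def)
  then have "\<And>\<delta>. \<delta> \<in> \<Lambda> \<Longrightarrow> prec m \<delta> \<Longrightarrow> prec a \<delta> \<and> prec b \<delta>"
    using m ab by (meson transp_onD)
  then show "\<exists>x\<in>\<Lambda>. principal {\<delta> \<in> \<Lambda>. prec x \<delta>}
      \<le> inf (principal {\<delta> \<in> \<Lambda>. prec a \<delta>}) (principal {\<delta> \<in> \<Lambda>. prec b \<delta>})"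
    using m(1) by (intro bexI[of _ m]) auto
qed (auto simp: eventually_principal)

lemma net_filter_neq_bot:
  assumes "net_index \<Lambda> prec"
  shows "net_filter \<Lambda> prec \<noteq> bot"
  using assms unfolding trivial_limit_def eventually_net_filter[OF assms] net_index_def by blast

lemma eventually_net_filter_mem:
  assumes "net_index \<Lambda> prec"
  shows "eventually (\<lambda>i. i \<in> \<Lambda>) (net_filter \<Lambda> prec)"
  using assms unfolding eventually_net_filter[OF assms] net_index_def by blast

lemma limitin_topology_generated_by:
  assumes ev: "\<And>U. U \<in> S \<Longrightarrow> l \<in> U \<Longrightarrow> eventually (\<lambda>i. f i \<in> U) F" and l: "l \<in> \<Union>S"
  shows "limitin (topology_generated_by S) f l F"
  unfolding limitin_def
proof (intro conjI allI impI)
  show "l \<in> topspace (topology_generated_by S)" using l by simp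
next
  fix U assume U: "openin (topology_generated_by S) U \<and> l \<in> U"
  then have "generate_topology_on S U" by (simp add: openin_topology_generated_by)
  then have "l \<in> U \<longrightarrow> eventually (\<lambda>i. f i \<in> U) F"
  proof (induction rule: generate_topology_on.induct)
    case (Int a b)
    then show ?case by (auto intro: eventually_conj)
  next
    case (UN K)
    show ?case
    proof
      assume "l \<in> \<Union>K"
      then obtain k where k: "k \<in> K" "l \<in> k" by blast
      then have "eventually (\<lambda>i. f i \<in> k) F" using UN by blast
      then show "eventually (\<lambda>i. f i \<in> \<Union>K) F" by (rule eventually_mono) (use k in blast)
    qed
  next
    case (Basis s)
    then show ?case using ev by auto
  qed simp
  with U show "eventually (\<lambda>i. f i \<in> U) F" by simp
qed

lemma limitin_smyth_iff:
  assumes mem: "eventually (\<lambda>i. x i \<in> X) F"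
  shows "limitin (smyth_topology X d) x l F \<longleftrightarrow>
    l \<in> X \<and> (\<forall>c\<in>X. ((\<lambda>i. enn2ereal (d c (x i))) \<longlongrightarrow> enn2ereal (d c l)) F)"
    (is "?L \<longleftrightarrow> ?R")
proof
  assume L: ?L
  then have l: "l \<in> X" by (auto simp: limitin_def smyth_topology_def)
  have "((\<lambda>i. enn2ereal (d c (x i))) \<longlongrightarrow> enn2ereal (d c l)) F" if c: "c \<in> X" for c
  proof (rule order_tendstoI)
    fix a assume "a < enn2ereal (d c l)"
    then obtain r where r: "a < ereal r" "ereal r < enn2ereal (d c l)" 
      using ereal_dense2 by blast
    let ?U = "{y \<in> X. enn2ereal (d c y) > ereal r}"
    have "openin (smyth_topology X d) ?U" unfolding smyth_topology_def
      by (rule topology_generated_by_Basis) (use c in blast)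
    then have "eventually (\<lambda>i. x i \<in> ?U) F"
      using L r l unfolding limitin_def by blast
    then show "eventually (\<lambda>i. a < enn2ereal (d c (x i))) F"
      by (rule eventually_mono) (use r in \<open>auto intro: less_trans\<close>)
  next
    fix a assume "enn2ereal (d c l) < a"
    then obtain r where r: "ereal r < a" "enn2ereal (d c l) < ereal r" 
      using ereal_dense2 by blast
    let ?U = "{y \<in> X. enn2ereal (d c y) < ereal r}"
    have "openin (smyth_topology X d) ?U" unfolding smyth_topology_def
      by (rule topology_generated_by_Basis) (use c in blast)
    then have "eventually (\<lambda>i. x i \<in> ?U) F"
      using L r l unfolding limitin_def by blast
    then show "eventually (\<lambda>i. enn2ereal (d c (x i)) < a) F"
      by (rule eventually_mono) (use r in \<open>auto intro: less_trans\<close>)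
  qed
  with l show ?R by blast
next
  assume R: ?R
  show ?L unfolding smyth_topology_def
  proof (rule limitin_topology_generated_by)
    fix U assume U: "U \<in> {{x \<in> X. enn2ereal (d c x) < ereal r} | c r. c \<in> X} \<union>
      {{x \<in> X. enn2ereal (d c x) > ereal r} | c r. c \<in> X}" and lU: "l \<in> U"
    then consider c r where "c \<in> X" "U = {x \<in> X. enn2ereal (d c x) < ereal r}"
      | c r where "c \<in> X" "U = {x \<in> X. enn2ereal (d c x) > ereal r}" by blast
    then show "eventually (\<lambda>i. x i \<in> U) F"
    proof cases
      case 1
      with R lU have "eventually (\<lambda>i. enn2ereal (d c (x i)) < ereal r) F"
        by (intro order_tendstoD(2)[where y = "enn2ereal (d c l)"]) auto
      with mem show ?thesis unfolding 1 by eventually_elim auto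
    next
      case 2
      with R lU have "eventually (\<lambda>i. enn2ereal (d c (x i)) > ereal r) F"
        by (intro order_tendstoD(1)[where y = "enn2ereal (d c l)"]) auto
      with mem show ?thesis unfolding 2 by eventually_elim auto
    qed
  next
    have "ereal (-1) < enn2ereal (d l l)"
      using enn2ereal_nonneg[of "d l l"] by (rule less_le_trans[rotated]) simp
    then show "l \<in> \<Union>({{x \<in> X. enn2ereal (d c x) < ereal r} | c r. c \<in> X} \<union>
      {{x \<in> X. enn2ereal (d c x) > ereal r} | c r. c \<in> X})"
      using R by blast
  qed
qed

lemma limitin_smyth_limits:
  assumes F: "F \<noteq> bot" and mem: "eventually (\<lambda>i. x i \<in> X) F"
    and L: "\<And>c. c \<in> X \<Longrightarrow> ((\<lambda>i. d c (x i)) \<longlongrightarrow> L c) F"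
  shows "limitin (smyth_topology X d) x l F \<longleftrightarrow> l \<in> X \<and> (\<forall>c\<in>X. L c = d c l)"
proof -
  have "((\<lambda>i. enn2ereal (d c (x i))) \<longlongrightarrow> enn2ereal (d c l)) F \<longleftrightarrow> L c = d c l"
    if c: "c \<in> X" for c
  proof -
    have lim: "((\<lambda>i. enn2ereal (d c (x i))) \<longlongrightarrow> enn2ereal (L c)) F"
      using L[OF c] by (rule tendsto_enn2erealI)
    show ?thesis
    proof
      assume "((\<lambda>i. enn2ereal (d c (x i))) \<longlongrightarrow> enn2ereal (d c l)) F"
      then have "enn2ereal (L c) = enn2ereal (d c l)" using tendsto_unique[OF F lim] by blast
      then show "L c = d c l" by (simp add: enn2ereal_inject)
    next
      assume "L c = d c l"
      with lim show "((\<lambda>i. enn2ereal (d c (x i))) \<longlongrightarrow> enn2ereal (d c l)) F" by simp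
    qed
  qed
  then show ?thesis unfolding limitin_smyth_iff[OF mem] by blast
qed

lemma Cauchy_net_convergent:
  assumes dist: "is_distance X d" and C: "Cauchy_net X d \<Lambda> prec x" and c: "c \<in> X"
  shows "\<exists>L. ((\<lambda>i. d c (x i)) \<longlongrightarrow> L) (net_filter \<Lambda> prec)"
proof -
  have ni: "net_index \<Lambda> prec" and xX: "\<And>i. i \<in> \<Lambda> \<Longrightarrow> x i \<in> X"
    using C by (auto simp: Cauchy_net_def)
  let ?F = "net_filter \<Lambda> prec"
  define s where "s = (\<lambda>\<gamma>. SUP \<delta>\<in>{\<delta> \<in> \<Lambda>. prec \<gamma> \<delta>}. d (x \<gamma>) (x \<delta>))"
  have s0: "(s \<longlongrightarrow> 0) ?F" using C by (simp add: Cauchy_net_def s_def)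
  have step: "d c (x \<delta>) \<le> d c (x \<gamma>) + s \<gamma>" if "\<gamma> \<in> \<Lambda>" "\<delta> \<in> \<Lambda>" "prec \<gamma> \<delta>" for \<gamma> \<delta>
  proof -
    have "d c (x \<delta>) \<le> d c (x \<gamma>) + d (x \<gamma>) (x \<delta>)"
      using dist c xX that by (simp add: is_distance_def)
    also have "d (x \<gamma>) (x \<delta>) \<le> s \<gamma>" unfolding s_def by (rule SUP_upper) (use that in auto)
    finally show ?thesis by (simp add: add_left_mono)
  qed
  define L where "L = Liminf ?F (\<lambda>i. d c (x i))"
  have "((\<lambda>i. d c (x i)) \<longlongrightarrow> L) ?F"
  proof (rule order_tendstoI)
    fix a assume "a < L"
    then show "eventually (\<lambda>i. a < d c (x i)) ?F"
      unfolding L_def by (rule less_LiminfD)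
  next
    fix a assume "L < a"
    then obtain b where b: "L < b" "b < a" using dense by blast
    have "\<not> eventually (\<lambda>i. b \<le> d c (x i)) ?F"
      using b(1) Liminf_bounded[of b "\<lambda>i. d c (x i)" ?F] unfolding L_def by auto
    then have fr: "frequently (\<lambda>i. d c (x i) < b) ?F"
      by (simp add: frequently_def not_less)
    have "0 < a - b" using b by (simp add: diff_gr0_ennreal)
    then have "eventually (\<lambda>i. s i < a - b) ?F" using s0 by (rule order_tendstoD(2)[rotated])
    then have ev: "eventually (\<lambda>i. s i < a - b \<and> i \<in> \<Lambda>) ?F"
      using eventually_net_filter_mem[OF ni] by (rule eventually_conj)
    have "frequently (\<lambda>i. d c (x i) < b \<and> (s i < a - b \<and> i \<in> \<Lambda>)) ?F"
    proof (rule frequently_rev_mp[OF fr])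
      show "eventually (\<lambda>i. d c (x i) < b \<longrightarrow> d c (x i) < b \<and> (s i < a - b \<and> i \<in> \<Lambda>)) ?F"
        using ev by (rule eventually_mono) simp
    qed
    then obtain \<gamma> where g: "d c (x \<gamma>) < b" "s \<gamma> < a - b" "\<gamma> \<in> \<Lambda>"
      by (blast dest: frequently_ex)
    have "d c (x \<delta>) < a" if "\<delta> \<in> \<Lambda>" "prec \<gamma> \<delta>" for \<delta>
    proof -
      have "d c (x \<delta>) \<le> d c (x \<gamma>) + s \<gamma>" using step that g by blast
      also have "\<dots> < b + (a - b)" using g by (intro add_strict_mono) auto
      also have "\<dots> = a" using b by (simp add: add_diff_inverse_ennreal)
      finally show ?thesis .
    qed
    then show "eventually (\<lambda>i. d c (x i) < a) ?F"
      unfolding eventually_net_filter[OF ni] using g by blast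
  qed
  then show ?thesis ..
qed

lemma net_finite_upper_bound:
  assumes ni: "net_index \<Lambda> prec" and "finite A" "A \<subseteq> \<Lambda>"
  shows "\<exists>k\<in>\<Lambda>. \<forall>a\<in>A. prec a k"
  using assms(2,3)
proof (induction A rule: finite_induct)
  case empty
  then show ?case using ni by (auto simp: net_index_def)
next
  case (insert a A)
  then obtain k where k: "k \<in> \<Lambda>" "\<forall>a\<in>A. prec a k" by auto
  obtain m where m: "m \<in> \<Lambda>" "prec a m" "prec k m"
    using ni k insert.prems unfolding net_index_def by blast
  have "transp_on \<Lambda> prec" using ni by (simp add: net_index_def)
  then have "\<forall>b\<in>A. prec b m" using k m insert.prems by (meson insert_subset subsetD transp_onD)
  then show ?case using m by auto
qed

lemma net_thinning:
  fixes \<Phi> :: "'p \<Rightarrow> 'i \<Rightarrow> bool"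
  assumes ni: "net_index \<Lambda> prec" and ev: "\<And>p. eventually (\<Phi> p) (net_filter \<Lambda> prec)"
  shows "\<exists>f. \<forall>F. finite F \<longrightarrow>
    f F \<in> \<Lambda> \<and> (\<forall>G. G \<subset> F \<longrightarrow> prec (f G) (f F)) \<and> (\<forall>p\<in>F. \<Phi> p (f F))"
proof -
  obtain g where g: "\<And>p. g p \<in> \<Lambda>" "\<And>p \<delta>. \<delta> \<in> \<Lambda> \<Longrightarrow> prec (g p) \<delta> \<Longrightarrow> \<Phi> p \<delta>"
    using ev unfolding eventually_net_filter[OF ni] by metis
  define P where "P = (\<lambda>f (F :: 'p set) r. finite F \<longrightarrow>
    r \<in> \<Lambda> \<and> (\<forall>G. G \<subset> F \<longrightarrow> prec (f G) r) \<and> (\<forall>p\<in>F. \<Phi> p r))"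
  have "\<exists>f. \<forall>F. P f F (f F)"
  proof (rule dependent_wf_choice[OF wf_finite_psubset])
    fix f f' :: "'p set \<Rightarrow> 'i" and F r
    assume "\<And>G. (G, F) \<in> finite_psubset \<Longrightarrow> f G = f' G"
    then show "P f F r = P f' F r" unfolding P_def finite_psubset_def by auto
  next
    fix F and f :: "'p set \<Rightarrow> 'i"
    assume IH: "\<And>G. (G, F) \<in> finite_psubset \<Longrightarrow> P f G (f G)"
    show "\<exists>r. P f F r"
    proof (cases "finite F")
      case True
      have "f G \<in> \<Lambda>" if "G \<subset> F" for G
        using IH[of G] that True finite_subset[of G F] by (auto simp: finite_psubset_def P_def)
      moreover have "finite {G. G \<subset> F}"
        using True by (rule rev_finite_subset[OF finite_Pow_iff[THEN iffD2]]) auto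
      ultimately obtain k where k: "k \<in> \<Lambda>" "\<forall>a\<in>f ` {G. G \<subset> F} \<union> g ` F. prec a k"
        using net_finite_upper_bound[OF ni, of "f ` {G. G \<subset> F} \<union> g ` F"] True g(1) by auto
      then have "P f F k" unfolding P_def using g(2) by auto
      then show ?thesis ..
    qed (simp add: P_def)
  qed
  then show ?thesis unfolding P_def .
qed

lemma Cauchy_net_reindex:
  fixes X :: "'a set" and \<Lambda> :: "'i set"
  assumes dist: "is_distance X d" and C: "Cauchy_net X d \<Lambda> prec x"
  shows "\<exists>(\<Lambda>' :: ('a \<times> nat) set set) prec' x'. Cauchy_net X d \<Lambda>' prec' x' \<and>
    (\<forall>l. limitin (smyth_topology X d) x' l (net_filter \<Lambda>' prec') \<longleftrightarrow>
         limitin (smyth_topology X d) x l (net_filter \<Lambda> prec))"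
proof -
  have ni: "net_index \<Lambda> prec" and xX: "\<And>i. i \<in> \<Lambda> \<Longrightarrow> x i \<in> X"
    using C by (auto simp: Cauchy_net_def)
  let ?F = "net_filter \<Lambda> prec"
  define s where "s = (\<lambda>\<gamma>. SUP \<delta>\<in>{\<delta> \<in> \<Lambda>. prec \<gamma> \<delta>}. d (x \<gamma>) (x \<delta>))"
  have s0: "(s \<longlongrightarrow> 0) ?F" using C by (simp add: Cauchy_net_def s_def)
  obtain L where L: "\<And>c. c \<in> X \<Longrightarrow> ((\<lambda>i. d c (x i)) \<longlongrightarrow> L c) ?F"
    using Cauchy_net_convergent[OF dist C] by metis
  have "\<forall>c. \<exists>A :: nat \<Rightarrow> ennreal set. (\<forall>n. open (A n) \<and> c \<in> A n) \<and>
    (\<forall>S. open S \<longrightarrow> c \<in> S \<longrightarrow> (\<exists>n. A n \<subseteq> S))"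
  proof
    fix c :: ennreal
    obtain A :: "nat \<Rightarrow> ennreal set" where A: "\<And>n. open (A n)" "\<And>n. c \<in> A n"
      "\<And>S. open S \<Longrightarrow> c \<in> S \<Longrightarrow> eventually (\<lambda>n. A n \<subseteq> S) sequentially"
      using countable_basis_at_decseq[of c] by metis
    have "\<exists>n. A n \<subseteq> S" if "open S" "c \<in> S" for S
      using A(3)[OF that] eventually_happens trivial_limit_sequentially by blast
    with A(1,2) show "\<exists>A :: nat \<Rightarrow> ennreal set. (\<forall>n. open (A n) \<and> c \<in> A n) \<and>
      (\<forall>S. open S \<longrightarrow> c \<in> S \<longrightarrow> (\<exists>n. A n \<subseteq> S))" by blast
  qed
  then obtain B :: "ennreal \<Rightarrow> nat \<Rightarrow> ennreal set"
    where B: "\<And>c n. open (B c n)" "\<And>c n. c \<in> B c n"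
      "\<And>c S. open S \<Longrightarrow> c \<in> S \<Longrightarrow> \<exists>n. B c n \<subseteq> S"
    by metis
  define \<Phi> where "\<Phi> = (\<lambda>(c, n) i. (c \<in> X \<longrightarrow> d c (x i) \<in> B (L c) n) \<and> s i \<in> B 0 n)"
  have "eventually (\<Phi> p) ?F" for p
  proof -
    obtain c n where p: "p = (c, n)" by force
    have "eventually (\<lambda>i. s i \<in> B 0 n) ?F" using s0 B by (auto intro: topological_tendstoD)
    moreover have "eventually (\<lambda>i. c \<in> X \<longrightarrow> d c (x i) \<in> B (L c) n) ?F"
      using L[of c] B by (cases "c \<in> X") (auto intro: topological_tendstoD)
    ultimately show ?thesis unfolding p \<Phi>_def by eventually_elim auto
  qed
  from net_thinning[of \<Lambda> prec \<Phi>, OF ni this] obtain f :: "('a \<times> nat) set \<Rightarrow> 'i" where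
    f: "\<And>F. finite F \<Longrightarrow> f F \<in> \<Lambda>" "\<And>F G. finite F \<Longrightarrow> G \<subset> F \<Longrightarrow> prec (f G) (f F)"
       "\<And>F p. finite F \<Longrightarrow> p \<in> F \<Longrightarrow> \<Phi> p (f F)" by metis
  define \<Lambda>' :: "('a \<times> nat) set set" where "\<Lambda>' = {F. finite F}"
  define prec' :: "('a \<times> nat) set \<Rightarrow> ('a \<times> nat) set \<Rightarrow> bool" where "prec' = (\<subset>)"
  let ?F' = "net_filter \<Lambda>' prec'"
  have inf: "infinite (UNIV :: ('a \<times> nat) set)" by (simp add: finite_prod)
  have ni': "net_index \<Lambda>' prec'" unfolding net_index_def
  proof (intro conjI ballI)
    show "\<Lambda>' \<noteq> {}" by (auto simp: \<Lambda>'_def)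
    show "transp_on \<Lambda>' prec'" by (auto simp: transp_on_def prec'_def)
    fix G H assume "G \<in> \<Lambda>'" "H \<in> \<Lambda>'"
    then have "finite (G \<union> H)" by (simp add: \<Lambda>'_def)
    moreover from this obtain p where "p \<notin> G \<union> H" using inf ex_new_if_finite by blast
    ultimately show "\<exists>\<mu>\<in>\<Lambda>'. prec' G \<mu> \<and> prec' H \<mu>"
      unfolding \<Lambda>'_def prec'_def by (intro bexI[of _ "insert p (G \<union> H)"]) auto
  qed
  have ev\<Phi>: "eventually (\<lambda>F. \<Phi> p (f F)) ?F'" for p
    unfolding eventually_net_filter[OF ni']
    by (rule bexI[of _ "{p}"]) (auto simp: \<Lambda>'_def prec'_def intro: f(3))
  have mem': "eventually (\<lambda>F. F \<in> \<Lambda>') ?F'" by (rule eventually_net_filter_mem[OF ni'])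
  define x' where "x' = x \<circ> f"
  have sf: "((\<lambda>F. s (f F)) \<longlongrightarrow> 0) ?F'"
  proof (rule topological_tendstoI)
    fix S :: "ennreal set" assume "open S" "0 \<in> S"
    then obtain n where n: "B 0 n \<subseteq> S" using B(3) by blast
    show "eventually (\<lambda>F. s (f F) \<in> S) ?F'"
      using ev\<Phi>[of "(undefined, n)"] by (rule eventually_mono) (use n in \<open>auto simp: \<Phi>_def\<close>)
  qed
  have lim': "((\<lambda>F. d c (x' F)) \<longlongrightarrow> L c) ?F'" if c: "c \<in> X" for c
  proof (rule topological_tendstoI)
    fix S :: "ennreal set" assume "open S" "L c \<in> S"
    then obtain n where n: "B (L c) n \<subseteq> S" using B(3) by blast
    show "eventually (\<lambda>F. d c (x' F) \<in> S) ?F'"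
      using ev\<Phi>[of "(c, n)"] by (rule eventually_mono) (use n c in \<open>auto simp: \<Phi>_def x'_def\<close>)
  qed
  have "((\<lambda>F. SUP G\<in>{G \<in> \<Lambda>'. prec' F G}. d (x' F) (x' G)) \<longlongrightarrow> 0) ?F'"
  proof (rule tendsto_sandwich[OF _ _ tendsto_const sf])
    show "eventually (\<lambda>F. (SUP G\<in>{G \<in> \<Lambda>'. prec' F G}. d (x' F) (x' G)) \<le> s (f F)) ?F'"
      using mem'
    proof eventually_elim
      case (elim F)
      show ?case
      proof (rule SUP_least)
        fix G assume "G \<in> {G \<in> \<Lambda>'. prec' F G}"
        then have "f G \<in> \<Lambda>" "prec (f F) (f G)" using f by (auto simp: \<Lambda>'_def prec'_def)
        then show "d (x' F) (x' G) \<le> s (f F)"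
          unfolding s_def x'_def comp_def by (intro SUP_upper2[of "f G"]) auto
      qed
    qed
  qed simp
  moreover have x'X: "x' ` \<Lambda>' \<subseteq> X" using f(1) xX by (auto simp: x'_def \<Lambda>'_def)
  ultimately have C': "Cauchy_net X d \<Lambda>' prec' x'" using ni' by (simp add: Cauchy_net_def)
  have k1: "limitin (smyth_topology X d) x l ?F \<longleftrightarrow> l \<in> X \<and> (\<forall>c\<in>X. L c = d c l)" for l
    using net_filter_neq_bot[OF ni] eventually_mono[OF eventually_net_filter_mem[OF ni] xX] L
    by (rule limitin_smyth_limits)
  have ev': "eventually (\<lambda>F. x' F \<in> X) ?F'"
    using mem' by (rule eventually_mono) (use x'X in blast)
  have k2: "limitin (smyth_topology X d) x' l ?F' \<longleftrightarrow> l \<in> X \<and> (\<forall>c\<in>X. L c = d c l)" for l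
    using net_filter_neq_bot[OF ni'] ev' lim' by (rule limitin_smyth_limits)
  have "\<forall>l. limitin (smyth_topology X d) x' l ?F' \<longleftrightarrow> limitin (smyth_topology X d) x l ?F"
    by (simp add: k1 k2)
  with C' have "Cauchy_net X d \<Lambda>' prec' x' \<and>
    (\<forall>l. limitin (smyth_topology X d) x' l ?F' \<longleftrightarrow> limitin (smyth_topology X d) x l ?F)" ..
  then show ?thesis by (intro exI)
qed

theorem smyth_complete_any_index:
  fixes X :: "'a set" and \<Lambda> :: "'i set"
  assumes "is_distance X d" "smyth_complete X d" "Cauchy_net X d \<Lambda> prec x"
  shows "\<exists>l\<in>X. limitin (smyth_topology X d) x l (net_filter \<Lambda> prec)"
proof -
  obtain \<Lambda>' :: "('a \<times> nat) set set" and prec' x' where C: "Cauchy_net X d \<Lambda>' prec' x'"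
    and lim: "\<forall>l. limitin (smyth_topology X d) x' l (net_filter \<Lambda>' prec') \<longleftrightarrow>
      limitin (smyth_topology X d) x l (net_filter \<Lambda> prec)"
    using Cauchy_net_reindex[OF assms(1,3)] by (elim exE conjE)
  obtain l where "l \<in> X" "limitin (smyth_topology X d) x' l (net_filter \<Lambda>' prec')"
    using assms(2)[unfolded smyth_complete_def, rule_format, OF C] by (elim bexE)
  with lim show ?thesis by (intro bexI[of _ l]) simp_all
qed

theorem smyth_continuous_any_index:
  fixes X :: "'a set"
  assumes "is_distance X d"
    and "\<And>l. l \<in> X \<Longrightarrow> \<exists>(\<Lambda> :: 'i set) prec x. Cauchy_net X d \<Lambda> prec x \<and>
           limitin (smyth_topology X d) x l (net_filter \<Lambda> prec)"
  shows "smyth_continuous X d"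
  unfolding smyth_continuous_def
proof
  fix l assume lX: "l \<in> X"
  obtain \<Lambda> :: "'i set" and prec x where C: "Cauchy_net X d \<Lambda> prec x"
    and l: "limitin (smyth_topology X d) x l (net_filter \<Lambda> prec)"
    using assms(2)[OF lX] by (elim exE conjE)
  obtain \<Lambda>' :: "('a \<times> nat) set set" and prec' x' where C': "Cauchy_net X d \<Lambda>' prec' x'"
    and lim: "\<forall>l. limitin (smyth_topology X d) x' l (net_filter \<Lambda>' prec') \<longleftrightarrow>
      limitin (smyth_topology X d) x l (net_filter \<Lambda> prec)"
    using Cauchy_net_reindex[OF assms(1) C] by (elim exE conjE)
  from lim l have "limitin (smyth_topology X d) x' l (net_filter \<Lambda>' prec')" by simp
  with C' have "Cauchy_net X d \<Lambda>' prec' x' \<and>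
    limitin (smyth_topology X d) x' l (net_filter \<Lambda>' prec')" ..
  then show "\<exists>(\<Lambda> :: ('a \<times> nat) set set) prec x. Cauchy_net X d \<Lambda> prec x \<and>
    limitin (smyth_topology X d) x l (net_filter \<Lambda> prec)" by (intro exI)
qed

end

theory Submission
  imports Defs
begin

text \<open>
  The strict order on formal balls has an elementary description: \<open>(x, r)\<close> lies below \<open>(y, s)\<close>
  iff \<open>d x y < r - s\<close> (\<open>ball_less_iff\<close>).  The topology enters twice.  A neighbourhood of
  \<open>(y, s)\<close> also contains \<open>(y, s + \<delta>)\<close> for small \<open>\<delta> > 0\<close>, which makes the inequality strict; and
  a strict inequality leaves room for a whole hemimetric ball around \<open>(y, s)\<close>.

  So going up in the order means moving to a point at distance less than the loss of radius.
  Cauchy nets in \<open>X\<close> and directed sets of balls are then two forms of the same data, and Smyth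
  limits correspond to maxima:

  \<^item> A Cauchy net \<open>x\<close> and a radius \<open>r \<ge> 0\<close> yield the directed set of all balls at \<open>x i\<close> whose radius
    exceeds \<open>r\<close> by more than the supremum of the distances from \<open>x i\<close> to later terms.
    Its maxima of radius \<open>r\<close> are the balls \<open>(l, r)\<close> with \<open>l\<close> a limit of \<open>x\<close>
    (\<open>directed_tail_balls\<close>, \<open>tail_balls_maximum_iff\<close>).

  \<^item> A directed set of balls, indexed by itself, is a net.  Its radii decrease to their infimum
    \<open>\<rho>\<close>, so their differences tend to \<open>0\<close>, and these bound the distances between centres; hence the
    centres form a Cauchy net.  The maxima of radius \<open>\<rho>\<close> are the balls \<open>(l, \<rho>)\<close>
    with \<open>l\<close> a limit of the centres (\<open>directed_balls\<close>, \<open>directed_balls_maximum_iff\<close>).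

  Both equivalences follow once the radius of a given maximum is known to be the one required
  here.  For completeness, the balls built from a Cauchy net with \<open>r = 0\<close> have arbitrarily small
  radii, which forces a maximum to have radius \<open>0\<close>.  For continuity, let \<open>(l, 0)\<close> be a maximum of
  \<open>Y\<close>; if there are points \<open>c\<close> with \<open>d c l\<close> arbitrarily small, then balls \<open>(c, \<epsilon>)\<close> of arbitrarily
  small radius lie below \<open>(l, 0)\<close>, hence below members of \<open>Y\<close>, so the radii in \<open>Y\<close> have infimum
  \<open>0\<close>.  Conversely, the members of a Cauchy net with limit \<open>l\<close> come arbitrarily close to \<open>l\<close>.
\<close>

section \<open>The strict order on formal balls\<close>

abbreviation ball_less :: "'a set \<Rightarrow> ('a \<Rightarrow> 'a \<Rightarrow> ennreal) \<Rightarrow> 'a \<times> real \<Rightarrow> 'a \<times> real \<Rightarrow> bool" where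
  "ball_less X d \<equiv> strict_order (formal_balls X) (ball_dist d)"

lemma pos_diff_le_iff: "pos_diff a b \<le> c \<longleftrightarrow> a \<le> b + c"
  by (auto simp: pos_diff_eq ennreal_minus_le_iff)

lemma lower_hemimetric_le_iff:
  "lower_hemimetric X d z y \<le> c \<longleftrightarrow> (\<forall>x\<in>X. d x y \<le> d x z + c)"
  by (simp add: lower_hemimetric_def SUP_le_iff pos_diff_le_iff)

lemma le_add_lower_hemimetric:
  "x \<in> X \<Longrightarrow> d x y \<le> d x z + lower_hemimetric X d z y"
  using lower_hemimetric_le_iff[of X d z y "lower_hemimetric X d z y"] by blast

lemma lower_hemimetric_self: "lower_hemimetric X d z z = 0"
  using lower_hemimetric_le_iff[of X d z z 0] by simp

lemma lower_hemimetric_triangle: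
  "lower_hemimetric X d u w \<le> lower_hemimetric X d u v + lower_hemimetric X d v w"
  unfolding lower_hemimetric_le_iff
proof
  fix x assume x: "x \<in> X"
  have "d x w \<le> d x v + lower_hemimetric X d v w" by (rule le_add_lower_hemimetric[OF x])
  also have "\<dots> \<le> (d x u + lower_hemimetric X d u v) + lower_hemimetric X d v w"
    by (intro add_right_mono le_add_lower_hemimetric[OF x])
  finally show "d x w \<le> d x u + (lower_hemimetric X d u v + lower_hemimetric X d v w)"
    by (simp add: add.assoc)
qed

lemma openin_hemiball:
  "c \<in> X \<Longrightarrow> 0 < e \<Longrightarrow> openin (hemiball_topology X d) {z \<in> X. lower_hemimetric X d c z < ennreal e}"
  unfolding hemiball_topology_def by (rule topology_generated_by_Basis) blast

text \<open>By the triangle inequality, the generating balls centred at a point form a neighbourhood base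
  there.\<close>

lemma openin_hemiball_topology_ball:
  assumes "openin (hemiball_topology X d) U" "y \<in> U"
  shows "\<exists>e>0. {z \<in> X. lower_hemimetric X d y z < ennreal e} \<subseteq> U"
proof -
  have "generate_topology_on
      {{z \<in> X. lower_hemimetric X d c z < ennreal r} | c r. c \<in> X \<and> 0 < r} U"
    using assms(1) by (simp add: hemiball_topology_def openin_topology_generated_by)
  then show ?thesis using assms(2)
  proof (induction arbitrary: y rule: generate_topology_on.induct)
    case (Int A B)
    then have "y \<in> A" "y \<in> B" by simp_all
    then obtain e f where "e > 0" "{z \<in> X. lower_hemimetric X d y z < ennreal e} \<subseteq> A"
      and "f > 0" "{z \<in> X. lower_hemimetric X d y z < ennreal f} \<subseteq> B"
      using Int.IH(1)[of y] Int.IH(2)[of y] by (elim exE conjE meta_impE) simp_all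
    moreover have "ennreal (min e f) \<le> ennreal e" "ennreal (min e f) \<le> ennreal f"
      by (simp_all add: ennreal_leI)
    ultimately have "{z \<in> X. lower_hemimetric X d y z < ennreal (min e f)} \<subseteq> A \<inter> B"
      by (blast intro: less_le_trans)
    with \<open>e > 0\<close> \<open>f > 0\<close> show ?case by (intro exI[of _ "min e f"]) simp
  next
    case (UN K)
    then obtain k where k: "k \<in> K" "y \<in> k" by blast
    from UN.IH[OF this] show ?case using k(1) by (elim exE conjE) (meson Union_upper order_trans)
  next
    case (Basis s)
    then obtain c r where s: "s = {z \<in> X. lower_hemimetric X d c z < ennreal r}" by blast
    let ?h = "lower_hemimetric X d"
    obtain a where a: "?h c y = ennreal a" "0 \<le> a" "a < r"
      using Basis s by (cases "?h c y") (auto simp: ennreal_less_iff)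
    have "?h c z < ennreal r" if z: "?h y z < ennreal (r - a)" for z
    proof -
      have "?h c z \<le> ennreal a + ?h y z"
        using lower_hemimetric_triangle[of X d c z y] a by simp
      also have "\<dots> < ennreal a + ennreal (r - a)" using z by simp
      also have "\<dots> = ennreal r" using a by (simp flip: ennreal_plus)
      finally show ?thesis .
    qed
    then have "{z \<in> X. ?h y z < ennreal (r - a)} \<subseteq> s" by (auto simp: s)
    with a show ?case by (intro exI[of _ "r - a"]) simp
  qed simp
qed

lemma ball_dist_eq:
  assumes "0 \<le> r" "0 \<le> s"
  shows "ball_dist d (x, r) (y, s) = d x y + ennreal s - ennreal r"
proof (cases "d x y")
  case (real u)
  then have "ball_dist d (x, r) (y, s) = e2ennreal (ereal (u - r + s))"
    by (simp add: ball_dist_def enn2ereal_ennreal)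
  also have "\<dots> = ennreal (u + s - r)" by (simp add: algebra_simps flip: ennreal.rep_eq e2ennreal_ereal)
  also have "\<dots> = ennreal (u + s) - ennreal r" using assms by (simp add: ennreal_minus)
  finally show ?thesis using real assms by (simp add: ennreal_plus)
next
  case top
  then show ?thesis using assms by (simp add: ball_dist_def)
qed

lemma ball_dist_le_iff:
  assumes "0 \<le> r" "0 \<le> s"
  shows "ball_dist d (x, r) (y, s) \<le> c \<longleftrightarrow> d x y + ennreal s \<le> ennreal r + c"
  by (simp add: ball_dist_eq[OF assms] ennreal_minus_le_iff)

lemma add_ennreal_less_iff:
  assumes "0 \<le> s"
  shows "a + ennreal s < ennreal r \<longleftrightarrow> a < ennreal (r - s)"
  using assms by (cases a) (auto simp: ennreal_less_iff simp flip: ennreal_plus)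

lemma less_ennreal_imp_pos: "a < ennreal r \<Longrightarrow> 0 < r"
  by (metis ennreal_neg not_less_zero not_le)

lemma ennreal_real_between:
  assumes "a < b"
  obtains t where "a < ennreal t" "ennreal t < b"
proof -
  obtain u where u: "a < u" "u < b" using dense[OF assms] by blast
  then show thesis using that by (cases u) auto
qed

text \<open>Left to right, enlarging the radius of \<open>(y, s)\<close> by \<open>\<delta>\<close> increases each distance to it by at most
  \<open>\<delta>\<close>, so a neighbourhood of \<open>(y, s)\<close> contains \<open>(y, s + \<delta>)\<close> for some \<open>\<delta> > 0\<close>, and then
  \<open>d x y + s + \<delta> \<le> r\<close>.  Right to left, the slack \<open>r - s - d x y\<close> is the radius of a hemimetric ball
  around \<open>(y, s)\<close> on which the distance from \<open>(x, r)\<close> vanishes.\<close>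

lemma ball_less_iff:
  "ball_less X d (x, r) (y, s) \<longleftrightarrow> x \<in> X \<and> y \<in> X \<and> 0 \<le> s \<and> d x y < ennreal (r - s)"
proof
  let ?B = "formal_balls X" and ?D = "ball_dist d"
  let ?H = "lower_hemimetric ?B ?D"
  assume L: "ball_less X d (x, r) (y, s)"
  then obtain U where U: "openin (hemiball_topology ?B ?D) U" "(y, s) \<in> U"
      "U \<subseteq> {z \<in> ?B. ?D (x, r) z = 0}"
    and mem: "x \<in> X" "y \<in> X" "0 \<le> r" "0 \<le> s"
    by (auto simp: strict_order_def formal_balls_def)
  obtain e where e: "e > 0" "{z \<in> ?B. ?H (y, s) z < ennreal e} \<subseteq> U"
    using openin_hemiball_topology_ball[OF U(1,2)] by blast
  have "?H (y, s) (y, s + e / 2) \<le> ennreal (e / 2)"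
    unfolding lower_hemimetric_le_iff
  proof
    fix p assume "p \<in> ?B"
    then obtain z t where p: "p = (z, t)" "0 \<le> t" by (auto simp: formal_balls_def)
    have "d z y + ennreal s \<le> ennreal t + ?D p (y, s)"
      using p mem by (simp flip: ball_dist_le_iff)
    then have "d z y + ennreal s + ennreal (e / 2) \<le> ennreal t + ?D p (y, s) + ennreal (e / 2)"
      by (rule add_right_mono)
    then show "?D p (y, s + e / 2) \<le> ?D p (y, s) + ennreal (e / 2)"
      using p mem e by (simp add: ball_dist_le_iff ennreal_plus add.assoc del: ennreal_plus[symmetric])
  qed
  also have "\<dots> < ennreal e" using e by (simp add: ennreal_less_iff)
  finally have "(y, s + e / 2) \<in> U" using e mem by (auto simp: formal_balls_def)
  with U(3) have "?D (x, r) (y, s + e / 2) \<le> 0" by auto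
  then have "d x y + ennreal (s + e / 2) \<le> ennreal r"
    using mem e by (simp add: ball_dist_le_iff del: le_zero_eq)
  then have "d x y < ennreal (r - s)"
    using mem e by (cases "d x y") (auto simp: ennreal_less_iff top_unique simp flip: ennreal_plus)
  with mem show "x \<in> X \<and> y \<in> X \<and> 0 \<le> s \<and> d x y < ennreal (r - s)" by simp
next
  let ?B = "formal_balls X" and ?D = "ball_dist d"
  let ?H = "lower_hemimetric ?B ?D"
  assume R: "x \<in> X \<and> y \<in> X \<and> 0 \<le> s \<and> d x y < ennreal (r - s)"
  then obtain u where u: "d x y = ennreal u" "0 \<le> u" "u < r - s"
    by (cases "d x y") (auto simp: ennreal_less_iff)
  have mem: "(x, r) \<in> ?B" "(y, s) \<in> ?B" "(x, 0) \<in> ?B"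
    using R u by (auto simp: formal_balls_def)
  let ?U = "{z \<in> ?B. ?H (y, s) z < ennreal (r - s - u)}"
  have "openin (hemiball_topology ?B ?D) ?U" using u mem by (intro openin_hemiball) auto
  moreover have "(y, s) \<in> ?U" using mem u by (simp add: lower_hemimetric_self)
  moreover have "?D (x, r) q = 0" if q: "q \<in> ?U" for q
  proof -
    obtain z t where zt: "q = (z, t)" "0 \<le> t" using q by (auto simp: formal_balls_def)
    \<comment> \<open>The distance from \<open>(x, r)\<close> is truncated at \<open>0\<close> and would lose the slack \<open>r - s - u\<close>;
      the distance from \<open>(x, 0)\<close> involves no truncation.\<close>
    have "d x z + ennreal t = ?D (x, 0) q" using zt by (simp add: ball_dist_eq)
    also have "\<dots> \<le> ?D (x, 0) (y, s) + ?H (y, s) q" by (rule le_add_lower_hemimetric[OF mem(3)])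
    also have "\<dots> = ennreal (u + s) + ?H (y, s) q"
      using R u by (simp add: ball_dist_eq ennreal_plus)
    also have "\<dots> \<le> ennreal (u + s) + ennreal (r - s - u)" using q by (intro add_left_mono) auto
    also have "\<dots> = ennreal r" using R u by (simp flip: ennreal_plus)
    finally have "?D (x, r) q \<le> 0" using zt R u by (simp add: ball_dist_le_iff del: le_zero_eq)
    then show ?thesis by simp
  qed
  ultimately show "ball_less X d (x, r) (y, s)"
    using mem unfolding strict_order_def by (intro conjI exI[of _ ?U]) auto
qed

lemma ball_less_trans:
  assumes dist: "is_distance X d" and "ball_less X d p q" "ball_less X d q w"
  shows "ball_less X d p w"
proof -
  obtain x r y s z t where eq: "p = (x, r)" "q = (y, s)" "w = (z, t)" by (metis surj_pair)
  have mem: "x \<in> X" "y \<in> X" "z \<in> X" "0 \<le> t"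
    and lt: "d x y < ennreal (r - s)" "d y z < ennreal (s - t)"
    using assms eq by (auto simp: ball_less_iff)
  have pos: "0 \<le> r - s" "0 \<le> s - t"
    using lt[THEN less_ennreal_imp_pos] by simp_all
  have "d x z \<le> d x y + d y z" using dist mem by (simp add: is_distance_def)
  also have "\<dots> < ennreal (r - s) + ennreal (s - t)" by (rule add_strict_mono[OF lt])
  also have "\<dots> = ennreal (r - t)" using pos by (simp flip: ennreal_plus)
  finally show ?thesis using mem by (simp add: eq ball_less_iff)
qed

section \<open>Limits of Cauchy nets\<close>

definition net_tail ::
  "('a \<Rightarrow> 'a \<Rightarrow> ennreal) \<Rightarrow> 'i set \<Rightarrow> ('i \<Rightarrow> 'i \<Rightarrow> bool) \<Rightarrow> ('i \<Rightarrow> 'a) \<Rightarrow> 'i \<Rightarrow> ennreal" where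
  "net_tail d \<Lambda> prec x \<gamma> = (SUP \<delta>\<in>{\<delta> \<in> \<Lambda>. prec \<gamma> \<delta>}. d (x \<gamma>) (x \<delta>))"

lemma dist_le_net_tail:
  "\<delta> \<in> \<Lambda> \<Longrightarrow> prec \<gamma> \<delta> \<Longrightarrow> d (x \<gamma>) (x \<delta>) \<le> net_tail d \<Lambda> prec x \<gamma>"
  unfolding net_tail_def by (rule SUP_upper) simp

lemma Cauchy_net_iff:
  "Cauchy_net X d \<Lambda> prec x \<longleftrightarrow>
     net_index \<Lambda> prec \<and> x ` \<Lambda> \<subseteq> X \<and> (net_tail d \<Lambda> prec x \<longlongrightarrow> 0) (net_filter \<Lambda> prec)"
  unfolding Cauchy_net_def net_tail_def[abs_def] ..

lemma Cauchy_net_smyth_limit_iff: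
  assumes "Cauchy_net X d \<Lambda> prec x"
  shows "limitin (smyth_topology X d) x l (net_filter \<Lambda> prec) \<longleftrightarrow>
    l \<in> X \<and> (\<forall>c\<in>X. ((\<lambda>i. d c (x i)) \<longlongrightarrow> d c l) (net_filter \<Lambda> prec))"
proof -
  have "eventually (\<lambda>i. x i \<in> X) (net_filter \<Lambda> prec)"
    using assms by (intro eventually_mono[OF eventually_net_filter_mem]) (auto simp: Cauchy_net_iff)
  from limitin_smyth_iff[OF this] show ?thesis
    by simp
qed

lemma dist_limit_le_net_tail:
  assumes C: "Cauchy_net X d \<Lambda> prec x"
    and lim: "limitin (smyth_topology X d) x l (net_filter \<Lambda> prec)" and i: "i \<in> \<Lambda>"
  shows "d (x i) l \<le> net_tail d \<Lambda> prec x i"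
proof (rule tendsto_upperbound)
  have ni: "net_index \<Lambda> prec" and "x i \<in> X" using C i by (auto simp: Cauchy_net_iff)
  with lim show "((\<lambda>j. d (x i) (x j)) \<longlongrightarrow> d (x i) l) (net_filter \<Lambda> prec)"
    by (simp add: Cauchy_net_smyth_limit_iff[OF C])
  show "eventually (\<lambda>j. d (x i) (x j) \<le> net_tail d \<Lambda> prec x i) (net_filter \<Lambda> prec)"
    unfolding eventually_net_filter[OF ni] by (intro bexI[OF _ i] ballI impI dist_le_net_tail)
  show "net_filter \<Lambda> prec \<noteq> bot" by (rule net_filter_neq_bot[OF ni])
qed

text \<open>Smyth convergence asks for \<open>d c (x i) \<longlongrightarrow> d c l\<close> for every \<open>c\<close>.  Its lower half is a
  consequence of \<open>d (x i) l \<longlongrightarrow> 0\<close>, since \<open>d c l \<le> d c (x i) + d (x i) l\<close>.\<close>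

lemma smyth_limit_criterion:
  assumes dist: "is_distance X d" and C: "Cauchy_net X d \<Lambda> prec x" and l: "l \<in> X"
    and to_l: "((\<lambda>i. d (x i) l) \<longlongrightarrow> 0) (net_filter \<Lambda> prec)"
    and upper: "\<And>c t. c \<in> X \<Longrightarrow> d c l < ennreal t \<Longrightarrow>
      \<exists>\<gamma>\<in>\<Lambda>. \<forall>\<delta>\<in>\<Lambda>. prec \<gamma> \<delta> \<longrightarrow> d c (x \<delta>) < ennreal t"
  shows "limitin (smyth_topology X d) x l (net_filter \<Lambda> prec)"
proof -
  have ni: "net_index \<Lambda> prec" and xX: "\<And>i. i \<in> \<Lambda> \<Longrightarrow> x i \<in> X"
    using C by (auto simp: Cauchy_net_iff)
  let ?F = "net_filter \<Lambda> prec"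
  have "((\<lambda>i. d c (x i)) \<longlongrightarrow> d c l) ?F" if c: "c \<in> X" for c
  proof (rule order_tendstoI)
    fix a assume "d c l < a"
    then obtain t where t: "d c l < ennreal t" "ennreal t < a" by (rule ennreal_real_between)
    have "eventually (\<lambda>i. d c (x i) < ennreal t) ?F"
      unfolding eventually_net_filter[OF ni] by (rule upper[OF c t(1)])
    then show "eventually (\<lambda>i. d c (x i) < a) ?F"
      by (rule eventually_mono) (use t in auto)
  next
    fix a assume "a < d c l"
    then obtain b where b: "a < b" "b < d c l" using dense by blast
    then have "0 < b - a" by (simp add: diff_gt_0_iff_gt_ennreal)
    with to_l have "eventually (\<lambda>i. d (x i) l < b - a) ?F" by (rule order_tendstoD)
    with eventually_net_filter_mem[OF ni] show "eventually (\<lambda>i. a < d c (x i)) ?F"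
    proof eventually_elim
      case (elim i)
      show ?case
      proof (rule ccontr)
        assume "\<not> a < d c (x i)"
        then have "d c (x i) + d (x i) l \<le> a + (b - a)" using elim by (intro add_mono) auto
        also have "\<dots> = b" using b by (simp add: add_diff_inverse_ennreal)
        also have "\<dots> < d c l" by (rule b)
        also have "\<dots> \<le> d c (x i) + d (x i) l" using dist c l xX elim by (simp add: is_distance_def)
        finally show False by simp
      qed
    qed
  qed
  with l show ?thesis by (simp add: Cauchy_net_smyth_limit_iff[OF C])
qed

section \<open>From Cauchy nets to directed sets of balls\<close>

lemma directed_subsetI:
  assumes "Y \<subseteq> P" "Y \<noteq> {}" and trans: "\<And>u v w. lt u v \<Longrightarrow> lt v w \<Longrightarrow> lt u w"
    and pair: "\<And>u v. u \<in> Y \<Longrightarrow> v \<in> Y \<Longrightarrow> \<exists>w\<in>Y. lt u w \<and> lt v w"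
  shows "directed_subset P lt Y"
proof -
  have "\<exists>y\<in>Y. \<forall>z\<in>F. lt z y" if "finite F" "F \<subseteq> Y" for F
    using that
  proof (induction F rule: finite_induct)
    case empty
    then show ?case using assms(2) by auto
  next
    case (insert u F)
    then obtain v where "v \<in> Y" "\<forall>z\<in>F. lt z v" by auto
    with pair[of u v] insert.prems show ?case using trans by (metis insert_iff subsetD)
  qed
  with assms(1) show ?thesis by (simp add: directed_subset_def)
qed

text \<open>The excess \<open>t\<close> of the radius over \<open>r\<close> is strictly above the tail of the net at \<open>i\<close>; this slack
  puts the ball below balls at all sufficiently late terms of a Cauchy net.  Every such \<open>t\<close> is admitted, so
  an upper bound of radius \<open>r\<close> has distance at most the tail from \<open>x i\<close>.  Indices with infinite
  tail contribute no ball.\<close>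

definition tail_balls :: "('a \<Rightarrow> 'a \<Rightarrow> ennreal) \<Rightarrow> 'i set \<Rightarrow> ('i \<Rightarrow> 'i \<Rightarrow> bool) \<Rightarrow> ('i \<Rightarrow> 'a) \<Rightarrow> real
    \<Rightarrow> ('a \<times> real) set" where
  "tail_balls d \<Lambda> prec x r = {(x i, r + t) | i t. i \<in> \<Lambda> \<and> net_tail d \<Lambda> prec x i < ennreal t}"

lemma eventually_net_tail_less:
  assumes "Cauchy_net X d \<Lambda> prec x" "0 < e"
  shows "eventually (\<lambda>i. \<exists>t. net_tail d \<Lambda> prec x i < ennreal t \<and> t < e) (net_filter \<Lambda> prec)"
proof -
  have "eventually (\<lambda>i. net_tail d \<Lambda> prec x i < ennreal (e / 2)) (net_filter \<Lambda> prec)"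
    using assms by (intro order_tendstoD(2)[of _ 0]) (auto simp: Cauchy_net_iff)
  then show ?thesis by (rule eventually_mono) (use assms(2) in \<open>auto intro!: exI[of _ "e / 2"]\<close>)
qed

text \<open>Two balls whose excess radii leave slack over their tails have a common upper bound at any
  later term whose own tail is smaller than both slacks; the Cauchy property provides one.\<close>

lemma directed_tail_balls:
  assumes dist: "is_distance X d" and C: "Cauchy_net X d \<Lambda> prec x" and r: "0 \<le> r"
  shows "directed_subset (formal_balls X) (ball_less X d) (tail_balls d \<Lambda> prec x r)"
proof (rule directed_subsetI)
  have ni: "net_index \<Lambda> prec" and xX: "\<And>i. i \<in> \<Lambda> \<Longrightarrow> x i \<in> X"
    using C by (auto simp: Cauchy_net_iff)
  let ?s = "net_tail d \<Lambda> prec x" and ?F = "net_filter \<Lambda> prec"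
  have F: "?F \<noteq> bot" by (rule net_filter_neq_bot[OF ni])
  have tpos: "0 < t" if "?s i < ennreal t" for i t
    using that by (rule less_ennreal_imp_pos)
  show "tail_balls d \<Lambda> prec x r \<subseteq> formal_balls X"
    using xX r by (auto simp: tail_balls_def formal_balls_def dest: tpos)
  obtain i where "i \<in> \<Lambda>" "\<exists>t. ?s i < ennreal t \<and> t < 1"
    using eventually_happens'[OF F eventually_conj[OF eventually_net_filter_mem[OF ni]
      eventually_net_tail_less[OF C zero_less_one]]] by blast
  then show "tail_balls d \<Lambda> prec x r \<noteq> {}" by (auto simp: tail_balls_def)
  fix u v assume "u \<in> tail_balls d \<Lambda> prec x r" "v \<in> tail_balls d \<Lambda> prec x r"
  then obtain i t j w where u: "u = (x i, r + t)" "i \<in> \<Lambda>" "?s i < ennreal t"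
    and v: "v = (x j, r + w)" "j \<in> \<Lambda>" "?s j < ennreal w"
    by (auto simp: tail_balls_def)
  obtain a where a: "?s i = ennreal a" "0 \<le> a" "a < t"
    using u by (cases "?s i") (auto simp: ennreal_less_iff)
  obtain b where b: "?s j = ennreal b" "0 \<le> b" "b < w"
    using v by (cases "?s j") (auto simp: ennreal_less_iff)
  have "eventually (\<lambda>k. k \<in> \<Lambda> \<and> prec i k \<and> prec j k) ?F"
  proof -
    have "eventually (prec i) ?F" "eventually (prec j) ?F"
      unfolding eventually_net_filter[OF ni] using u v by blast+
    with eventually_net_filter_mem[OF ni] show ?thesis by eventually_elim simp
  qed
  moreover have "eventually (\<lambda>k. \<exists>e. ?s k < ennreal e \<and> e < min (t - a) (w - b)) ?F"
    using a b by (intro eventually_net_tail_less[OF C]) auto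
  ultimately have "\<exists>k. (k \<in> \<Lambda> \<and> prec i k \<and> prec j k) \<and>
      (\<exists>e. ?s k < ennreal e \<and> e < min (t - a) (w - b))"
    using eventually_happens'[OF F eventually_conj] by blast
  then obtain k e where k: "k \<in> \<Lambda>" "prec i k" "prec j k"
    and e: "?s k < ennreal e" "e < t - a" "e < w - b" by auto
  have "d (x i) (x k) \<le> ennreal a" "d (x j) (x k) \<le> ennreal b"
    using dist_le_net_tail[of k \<Lambda> prec _ d x] k a b by metis+
  moreover have "ennreal a < ennreal (t - e)" "ennreal b < ennreal (w - e)"
    using a b e by (auto simp: ennreal_less_iff)
  ultimately have "d (x i) (x k) < ennreal (t - e)" "d (x j) (x k) < ennreal (w - e)"
    by (auto intro: le_less_trans)
  then have "ball_less X d u (x k, r + e) \<and> ball_less X d v (x k, r + e)"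
    using u v k xX r tpos[OF e(1)] by (simp add: ball_less_iff)
  moreover have "(x k, r + e) \<in> tail_balls d \<Lambda> prec x r" using k e by (auto simp: tail_balls_def)
  ultimately show "\<exists>w\<in>tail_balls d \<Lambda> prec x r. ball_less X d u w \<and> ball_less X d v w" by blast
qed (rule ball_less_trans[OF dist])

text \<open>That \<open>(l, r)\<close> is above every ball of the family says that \<open>d (x i) l\<close> is bounded by the tail at
  \<open>i\<close>, so it tends to \<open>0\<close>.  That each ball \<open>(c, r + t)\<close> below \<open>(l, r)\<close> is
  below a member of the family says that \<open>d c l < t\<close> implies \<open>d c (x j) < t\<close> from some index on,
  which is the remaining upper half.\<close>

lemma tail_balls_maximum_iff:
  assumes dist: "is_distance X d" and C: "Cauchy_net X d \<Lambda> prec x" and r: "0 \<le> r"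
  shows "is_maximum (formal_balls X) (ball_less X d) (tail_balls d \<Lambda> prec x r) (l, r) \<longleftrightarrow>
    limitin (smyth_topology X d) x l (net_filter \<Lambda> prec)"
proof
  have ni: "net_index \<Lambda> prec" and xX: "\<And>i. i \<in> \<Lambda> \<Longrightarrow> x i \<in> X"
    and s0: "(net_tail d \<Lambda> prec x \<longlongrightarrow> 0) (net_filter \<Lambda> prec)"
    using C by (auto simp: Cauchy_net_iff)
  let ?s = "net_tail d \<Lambda> prec x" and ?F = "net_filter \<Lambda> prec" and ?Y = "tail_balls d \<Lambda> prec x r"
  {
    assume M: "is_maximum (formal_balls X) (ball_less X d) ?Y (l, r)"
    then have l: "l \<in> X" by (simp add: is_maximum_def formal_balls_def)
    have "d (x i) l \<le> ?s i" if i: "i \<in> \<Lambda>" for i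
    proof (rule dense_ge)
      fix a assume "?s i < a"
      then obtain t where t: "?s i < ennreal t" "ennreal t < a" by (rule ennreal_real_between)
      then have "(x i, r + t) \<in> ?Y" using i by (auto simp: tail_balls_def)
      with M have "ball_less X d (x i, r + t) (l, r)" by (simp add: is_maximum_def)
      with t show "d (x i) l \<le> a" by (auto simp: ball_less_iff)
    qed
    then have "((\<lambda>i. d (x i) l) \<longlongrightarrow> 0) ?F"
      using eventually_net_filter_mem[OF ni]
      by (intro tendsto_sandwich[OF _ _ tendsto_const s0]) (auto elim: eventually_mono)
    then show "limitin (smyth_topology X d) x l ?F"
    proof (rule smyth_limit_criterion[OF dist C l])
      fix c t assume c: "c \<in> X" "d c l < ennreal t"
      then have "ball_less X d (c, r + t) (l, r)" using l r by (simp add: ball_less_iff)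
      moreover have "0 < t" by (rule less_ennreal_imp_pos[OF c(2)])
      ultimately obtain y where "y \<in> ?Y" "ball_less X d (c, r + t) y"
        using M c r unfolding is_maximum_def formal_balls_def by force
      then obtain i e where i: "i \<in> \<Lambda>" "?s i < ennreal e" "d c (x i) < ennreal (t - e)"
        by (auto simp: tail_balls_def ball_less_iff)
      have "d c (x j) < ennreal t" if j: "j \<in> \<Lambda>" "prec i j" for j
      proof -
        have "d c (x j) \<le> d c (x i) + d (x i) (x j)"
          using dist c i j xX by (simp add: is_distance_def)
        also have "\<dots> \<le> d c (x i) + ?s i" using j by (intro add_left_mono dist_le_net_tail)
        also have "\<dots> < ennreal (t - e) + ennreal e" using i by (intro add_strict_mono)
        also have "\<dots> = ennreal t"
        proof -
          have "0 < e" "0 < t - e" using i by (auto dest: less_ennreal_imp_pos)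
          then show ?thesis by (simp flip: ennreal_plus)
        qed
        finally show ?thesis .
      qed
      with i show "\<exists>\<gamma>\<in>\<Lambda>. \<forall>\<delta>\<in>\<Lambda>. prec \<gamma> \<delta> \<longrightarrow> d c (x \<delta>) < ennreal t" by blast
    qed
  }
  assume lim: "limitin (smyth_topology X d) x l ?F"
  then have l: "l \<in> X" and dl: "\<And>c. c \<in> X \<Longrightarrow> ((\<lambda>i. d c (x i)) \<longlongrightarrow> d c l) ?F"
    by (auto simp: Cauchy_net_smyth_limit_iff[OF C])
  show "is_maximum (formal_balls X) (ball_less X d) ?Y (l, r)"
    unfolding is_maximum_def
  proof (intro conjI ballI impI)
    show "(l, r) \<in> formal_balls X" using l r by (simp add: formal_balls_def)
  next
    fix y assume "y \<in> ?Y"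
    then obtain i t where y: "y = (x i, r + t)" "i \<in> \<Lambda>" "?s i < ennreal t"
      by (auto simp: tail_balls_def)
    have "d (x i) l < ennreal t"
      using dist_limit_le_net_tail[OF C lim y(2)] y(3) by (rule le_less_trans)
    with y l r xX show "ball_less X d y (l, r)" by (simp add: ball_less_iff)
  next
    fix p assume "ball_less X d p (l, r)"
    then obtain c u where p: "p = (c, u)" "c \<in> X" "d c l < ennreal (u - r)"
      by (cases p) (auto simp: ball_less_iff)
    then obtain a where a: "d c l < ennreal a" "a < u - r" "0 \<le> a"
    proof -
      obtain b where "d c l = ennreal b" "0 \<le> b" "b < u - r"
        using p by (cases "d c l") (auto simp: ennreal_less_iff)
      then show ?thesis by (intro that[of "(b + (u - r)) / 2"]) (auto simp: ennreal_less_iff field_simps)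
    qed
    have "eventually (\<lambda>i. d c (x i) < ennreal a) ?F" by (rule order_tendstoD(2)[OF dl[OF p(2)] a(1)])
    moreover have "eventually (\<lambda>i. \<exists>t. ?s i < ennreal t \<and> t < u - r - a) ?F"
      using a by (intro eventually_net_tail_less[OF C]) simp
    ultimately have "eventually (\<lambda>i. i \<in> \<Lambda> \<and> d c (x i) < ennreal a \<and>
        (\<exists>t. ?s i < ennreal t \<and> t < u - r - a)) ?F"
      using eventually_net_filter_mem[OF ni] by eventually_elim simp
    then obtain i t where i: "i \<in> \<Lambda>" "d c (x i) < ennreal a" "?s i < ennreal t" "t < u - r - a"
      using eventually_happens'[OF net_filter_neq_bot[OF ni]] by blast
    have "0 < t" using i(3) by (rule less_ennreal_imp_pos)
    moreover have "d c (x i) < ennreal (u - (r + t))"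
      using i(2) by (rule less_le_trans) (use i in \<open>intro ennreal_leI, simp\<close>)
    ultimately have "ball_less X d p (x i, r + t)" using p i xX r by (simp add: ball_less_iff)
    moreover have "(x i, r + t) \<in> ?Y" using i by (auto simp: tail_balls_def)
    ultimately show "\<exists>y\<in>?Y. ball_less X d p y" by blast
  qed
qed

section \<open>From directed sets of balls to Cauchy nets\<close>

text \<open>The radii decrease strictly along the order, so they converge to their infimum.  Since
  \<open>(x, r)\<close> below \<open>(y, s)\<close> gives \<open>d x y < r - s\<close>, the tail of the net of centres at \<open>(x, r)\<close> is at most
  \<open>r - \<rho>\<close>, which tends to \<open>0\<close>.\<close>

lemma directed_balls:
  assumes dist: "is_distance X d"
    and Y: "directed_subset (formal_balls X) (ball_less X d) Y"
  defines "\<rho> \<equiv> Inf (snd ` Y)"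
  shows directed_balls_Inf_nonneg: "0 \<le> \<rho>"
    and directed_balls_Inf_less: "p \<in> Y \<Longrightarrow> \<rho> < snd p"
    and directed_balls_radius_tendsto: "(snd \<longlongrightarrow> \<rho>) (net_filter Y (ball_less X d))"
    and directed_balls_Cauchy_net: "Cauchy_net X d Y (ball_less X d) fst"
proof -
  let ?lt = "ball_less X d"
  let ?F = "net_filter Y ?lt"
  have YB: "\<And>p. p \<in> Y \<Longrightarrow> fst p \<in> X \<and> 0 \<le> snd p"
    using Y by (auto simp: directed_subset_def formal_balls_def)
  have dir: "\<And>F. finite F \<Longrightarrow> F \<subseteq> Y \<Longrightarrow> \<exists>y\<in>Y. \<forall>z\<in>F. ?lt z y"
    using Y by (simp add: directed_subset_def)
  have bdd: "bdd_below (snd ` Y)" by (rule bdd_belowI[of _ 0]) (use YB in auto)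
  have ne: "Y \<noteq> {}" using dir[of "{}"] by auto
  show "0 \<le> \<rho>" unfolding \<rho>_def by (rule cINF_greatest) (use ne YB in auto)
  have ni: "net_index Y ?lt" unfolding net_index_def
  proof (intro conjI ballI ne)
    show "transp_on Y ?lt" by (rule transp_onI) (rule ball_less_trans[OF dist])
    fix p q assume "p \<in> Y" "q \<in> Y"
    then show "\<exists>w\<in>Y. ?lt p w \<and> ?lt q w" using dir[of "{p, q}"] by auto
  qed
  have lt: "d (fst p) (fst q) < ennreal (snd p - snd q)" "snd q < snd p" if "?lt p q" for p q
  proof -
    show 1: "d (fst p) (fst q) < ennreal (snd p - snd q)"
      using that by (cases p, cases q) (simp add: ball_less_iff)
    show "snd q < snd p" using less_ennreal_imp_pos[OF 1] by simp
  qed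
  have less: "\<rho> < snd p" if p: "p \<in> Y" for p
  proof -
    obtain q where q: "q \<in> Y" "?lt p q" using dir[of "{p}"] p by blast
    have "\<rho> \<le> snd q" unfolding \<rho>_def by (rule cINF_lower[OF bdd q(1)])
    also have "\<dots> < snd p" by (rule lt(2)[OF q(2)])
    finally show ?thesis .
  qed
  show "\<rho> < snd p" if "p \<in> Y" using less that .
  show radius: "(snd \<longlongrightarrow> \<rho>) ?F"
  proof (rule order_tendstoI)
    fix a assume "a < \<rho>"
    then show "eventually (\<lambda>p. a < snd p) ?F"
      by (intro eventually_mono[OF eventually_net_filter_mem[OF ni]]) (auto dest: less)
  next
    fix a assume "\<rho> < a"
    then obtain p where p: "p \<in> Y" "snd p < a"
      unfolding \<rho>_def using cINF_less_iff[OF ne bdd] by blast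
    then show "eventually (\<lambda>p. snd p < a) ?F"
      unfolding eventually_net_filter[OF ni] by (blast dest: lt(2) intro: less_trans)
  qed
  have "(net_tail d Y ?lt fst \<longlongrightarrow> 0) ?F"
  proof (rule tendsto_sandwich[OF _ _ tendsto_const])
    have "((\<lambda>p. snd p - \<rho>) \<longlongrightarrow> \<rho> - \<rho>) ?F" by (intro tendsto_intros radius)
    then show "((\<lambda>p. ennreal (snd p - \<rho>)) \<longlongrightarrow> 0) ?F"
      using tendsto_ennrealI by fastforce
    have "net_tail d Y ?lt fst p \<le> ennreal (snd p - \<rho>)" if "p \<in> Y" for p
      unfolding net_tail_def
    proof (rule SUP_least)
      fix q assume q: "q \<in> {q \<in> Y. ?lt p q}"
      then have "d (fst p) (fst q) \<le> ennreal (snd p - snd q)" using lt(1)[of p q] by simp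
      also have "\<dots> \<le> ennreal (snd p - \<rho>)" using less[of q] q by (intro ennreal_leI) simp
      finally show "d (fst p) (fst q) \<le> ennreal (snd p - \<rho>)" .
    qed
    then show "eventually (\<lambda>p. net_tail d Y ?lt fst p \<le> ennreal (snd p - \<rho>)) ?F"
      by (rule eventually_mono[OF eventually_net_filter_mem[OF ni]])
  qed simp
  then show "Cauchy_net X d Y ?lt fst" using ni YB by (auto simp: Cauchy_net_iff)
qed

text \<open>As for the balls built from a net, being an upper bound controls \<open>d (fst p) l\<close>, here by
  \<open>snd p - \<rho>\<close>, and being approximated from below controls \<open>d c (fst p)\<close> from above.\<close>

lemma directed_balls_maximum_iff:
  assumes dist: "is_distance X d"
    and Y: "directed_subset (formal_balls X) (ball_less X d) Y"
  defines "\<rho> \<equiv> Inf (snd ` Y)"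
  shows "is_maximum (formal_balls X) (ball_less X d) Y (l, \<rho>) \<longleftrightarrow>
    limitin (smyth_topology X d) fst l (net_filter Y (ball_less X d))"
proof
  let ?lt = "ball_less X d"
  let ?F = "net_filter Y ?lt"
  note D = directed_balls[OF dist Y, folded \<rho>_def]
  note C = D(4)
  have ni: "net_index Y ?lt" using C by (simp add: Cauchy_net_iff)
  {
    assume M: "is_maximum (formal_balls X) ?lt Y (l, \<rho>)"
    then have l: "l \<in> X" by (simp add: is_maximum_def formal_balls_def)
    have "((\<lambda>p. d (fst p) l) \<longlongrightarrow> 0) ?F"
    proof (rule tendsto_sandwich[OF _ _ tendsto_const])
      have "((\<lambda>p. snd p - \<rho>) \<longlongrightarrow> \<rho> - \<rho>) ?F" by (intro tendsto_intros D(3))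
      then show "((\<lambda>p. ennreal (snd p - \<rho>)) \<longlongrightarrow> 0) ?F"
        using tendsto_ennrealI by fastforce
      have "d (fst p) l \<le> ennreal (snd p - \<rho>)" if "p \<in> Y" for p
      proof -
        have "?lt p (l, \<rho>)" using M that by (simp add: is_maximum_def)
        then show ?thesis by (cases p) (simp add: ball_less_iff less_imp_le)
      qed
      then show "eventually (\<lambda>p. d (fst p) l \<le> ennreal (snd p - \<rho>)) ?F"
        by (rule eventually_mono[OF eventually_net_filter_mem[OF ni]])
    qed simp
    then show "limitin (smyth_topology X d) fst l ?F"
    proof (rule smyth_limit_criterion[OF dist C l])
      fix c t assume c: "c \<in> X" "d c l < ennreal t"
      then have "?lt (c, \<rho> + t) (l, \<rho>)" using l D(1) by (simp add: ball_less_iff)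
      moreover have "0 < t" by (rule less_ennreal_imp_pos[OF c(2)])
      with c(1) D(1) have "(c, \<rho> + t) \<in> formal_balls X" by (simp add: formal_balls_def)
      ultimately obtain p where p: "p \<in> Y" "?lt (c, \<rho> + t) p"
        using M unfolding is_maximum_def by blast
      have "d c (fst q) < ennreal t" if q: "q \<in> Y" "?lt p q" for q
      proof -
        have "?lt (c, \<rho> + t) q" by (rule ball_less_trans[OF dist p(2) q(2)])
        then have "d c (fst q) < ennreal (\<rho> + t - snd q)" by (cases q) (simp add: ball_less_iff)
        also have "\<dots> \<le> ennreal t" using D(2)[OF q(1)] by (intro ennreal_leI) simp
        finally show ?thesis .
      qed
      with p show "\<exists>p\<in>Y. \<forall>q\<in>Y. ?lt p q \<longrightarrow> d c (fst q) < ennreal t" by blast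
    qed
  }
  assume lim: "limitin (smyth_topology X d) fst l ?F"
  then have l: "l \<in> X" and dl: "\<And>c. c \<in> X \<Longrightarrow> ((\<lambda>p. d c (fst p)) \<longlongrightarrow> d c l) ?F"
    by (auto simp: Cauchy_net_smyth_limit_iff[OF C])
  show "is_maximum (formal_balls X) ?lt Y (l, \<rho>)"
    unfolding is_maximum_def
  proof (intro conjI ballI impI)
    show "(l, \<rho>) \<in> formal_balls X" using l D(1) by (simp add: formal_balls_def)
  next
    fix p assume p: "p \<in> Y"
    \<comment> \<open>Passing to the limit only gives \<open>d y l \<le> s - \<rho>\<close>; the strict inequality for \<open>p\<close> comes from
      the step from \<open>p\<close> to a larger ball \<open>q = (y, s)\<close>.\<close>
    then obtain q where q: "q \<in> Y" "?lt p q" using ni unfolding net_index_def by blast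
    obtain x r y s where eq: "p = (x, r)" "q = (y, s)" by (metis surj_pair)
    have xy: "x \<in> X" "y \<in> X" "d x y < ennreal (r - s)" using q eq by (auto simp: ball_less_iff)
    have s: "\<rho> < s" using D(2)[OF q(1)] eq by simp
    have "d y l \<le> ennreal (s - \<rho>)"
    proof (rule tendsto_upperbound[OF dl[OF xy(2)] _ net_filter_neq_bot[OF ni]])
      have "d y (fst w) \<le> ennreal (s - \<rho>)" if w: "w \<in> Y" "?lt q w" for w
      proof -
        have "d y (fst w) < ennreal (s - snd w)" using w eq by (cases w) (simp add: ball_less_iff)
        also have "\<dots> \<le> ennreal (s - \<rho>)" using D(2)[OF w(1)] by (intro ennreal_leI) simp
        finally show ?thesis by simp
      qed
      with q show "eventually (\<lambda>w. d y (fst w) \<le> ennreal (s - \<rho>)) ?F"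
        unfolding eventually_net_filter[OF ni] by blast
    qed
    have "d x l \<le> d x y + d y l" using dist xy l by (simp add: is_distance_def)
    also have "\<dots> \<le> d x y + ennreal (s - \<rho>)" by (rule add_left_mono) fact
    also have "\<dots> < ennreal (r - \<rho>)"
      using xy(3) s by (simp add: add_ennreal_less_iff)
    finally show "?lt p (l, \<rho>)" using eq xy l D(1) by (simp add: ball_less_iff)
  next
    fix p assume "?lt p (l, \<rho>)"
    then obtain c u where p: "p = (c, u)" "c \<in> X" "d c l < ennreal (u - \<rho>)"
      by (cases p) (auto simp: ball_less_iff)
    have "((\<lambda>q. d c (fst q) + ennreal (snd q)) \<longlongrightarrow> d c l + ennreal \<rho>) ?F"
      by (rule tendsto_add[OF dl[OF p(2)] tendsto_ennrealI[OF D(3)]])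
    moreover have "d c l + ennreal \<rho> < ennreal u" using p D(1) by (simp add: add_ennreal_less_iff)
    ultimately have "eventually (\<lambda>q. d c (fst q) + ennreal (snd q) < ennreal u) ?F"
      by (rule order_tendstoD(2))
    then have "eventually (\<lambda>q. q \<in> Y \<and> d c (fst q) + ennreal (snd q) < ennreal u) ?F"
      using eventually_net_filter_mem[OF ni] by eventually_elim simp
    then obtain q where q: "q \<in> Y" "d c (fst q) + ennreal (snd q) < ennreal u"
      using eventually_happens'[OF net_filter_neq_bot[OF ni]] by blast
    have "fst q \<in> X" using C q(1) by (auto simp: Cauchy_net_iff)
    moreover have "0 \<le> snd q" using D(1) D(2)[OF q(1)] by simp
    ultimately have "?lt p q" using q p by (cases q) (simp add: ball_less_iff add_ennreal_less_iff)
    with q show "\<exists>y\<in>Y. ?lt p y" by blast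
  qed
qed

section \<open>Completeness and continuity\<close>

text \<open>A maximum of the balls built from a Cauchy net with \<open>r = 0\<close> has smaller radius than each of them,
  and some of them are arbitrarily small; so its radius is \<open>0\<close> and its centre is a limit.\<close>

theorem smyth_complete_iff_max_complete:
  assumes dist: "is_distance X d"
  shows "smyth_complete X d \<longleftrightarrow> max_complete (formal_balls X) (ball_less X d)"
proof
  assume S: "smyth_complete X d"
  show "max_complete (formal_balls X) (ball_less X d)"
    unfolding max_complete_def
  proof (intro allI impI)
    fix Y assume Y: "directed_subset (formal_balls X) (ball_less X d) Y"
    obtain l where "limitin (smyth_topology X d) fst l (net_filter Y (ball_less X d))"
      using smyth_complete_any_index[OF dist S directed_balls_Cauchy_net[OF dist Y]] by blast
    then have "is_maximum (formal_balls X) (ball_less X d) Y (l, Inf (snd ` Y))"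
      by (simp add: directed_balls_maximum_iff[OF dist Y])
    then show "\<exists>x\<in>formal_balls X. is_maximum (formal_balls X) (ball_less X d) Y x"
      unfolding is_maximum_def by blast
  qed
next
  assume M: "max_complete (formal_balls X) (ball_less X d)"
  show "smyth_complete X d"
    unfolding smyth_complete_def
  proof (intro allI impI)
    fix \<Lambda> :: "('a \<times> nat) set set" and prec x assume C: "Cauchy_net X d \<Lambda> prec x"
    let ?Y = "tail_balls d \<Lambda> prec x 0"
    obtain l s where max: "is_maximum (formal_balls X) (ball_less X d) ?Y (l, s)"
      using M directed_tail_balls[OF dist C, of 0] unfolding max_complete_def by force
    have ni: "net_index \<Lambda> prec" using C by (simp add: Cauchy_net_iff)
    have "s \<le> e" if e: "0 < e" for e
    proof -
      obtain i t where i: "i \<in> \<Lambda>" "net_tail d \<Lambda> prec x i < ennreal t" "t < e"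
        using eventually_happens'[OF net_filter_neq_bot[OF ni] eventually_conj[OF
          eventually_net_filter_mem[OF ni] eventually_net_tail_less[OF C e]]] by blast
      then have "(x i, t) \<in> ?Y" by (force simp: tail_balls_def)
      with max have "ball_less X d (x i, t) (l, s)" by (simp add: is_maximum_def)
      then have "0 < t - s" by (auto simp: ball_less_iff dest: less_ennreal_imp_pos)
      then show "s \<le> e" using i by simp
    qed
    then have "s \<le> 0" by (rule field_le_epsilon[of s 0, simplified])
    moreover have "0 \<le> s" "l \<in> X" using max by (auto simp: is_maximum_def formal_balls_def)
    ultimately show "\<exists>l\<in>X. limitin (smyth_topology X d) x l (net_filter \<Lambda> prec)"
      using max tail_balls_maximum_iff[OF dist C, of 0 l] by auto
  qed
qed

text \<open>The infimum condition yields balls of arbitrarily small radius below \<open>(l, 0)\<close>.  Hence any directed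
  set with maximum \<open>(l, 0)\<close> has radii with infimum \<open>0\<close>, and its centres converge to \<open>l\<close>.\<close>

theorem smyth_continuous_iff_max_continuous:
  assumes dist: "is_distance X d"
  shows "smyth_continuous X d \<longleftrightarrow>
    max_continuous (formal_balls X) (ball_less X d) \<and> (\<forall>x\<in>X. (INF y\<in>X. d y x) = 0)"
proof
  assume S: "smyth_continuous X d"
  show "max_continuous (formal_balls X) (ball_less X d) \<and> (\<forall>x\<in>X. (INF y\<in>X. d y x) = 0)"
  proof
    show "max_continuous (formal_balls X) (ball_less X d)"
      unfolding max_continuous_def
    proof
      fix p assume "p \<in> formal_balls X"
      then obtain l r where p: "p = (l, r)" "l \<in> X" "0 \<le> r" by (auto simp: formal_balls_def)
      obtain \<Lambda> :: "('a \<times> nat) set set" and prec x where C: "Cauchy_net X d \<Lambda> prec x"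
        and "limitin (smyth_topology X d) x l (net_filter \<Lambda> prec)"
        using S[unfolded smyth_continuous_def, rule_format, OF p(2)] by (elim exE conjE)
      then show "\<exists>Y. directed_subset (formal_balls X) (ball_less X d) Y \<and>
          is_maximum (formal_balls X) (ball_less X d) Y p"
        using directed_tail_balls[OF dist C p(3)] tail_balls_maximum_iff[OF dist C p(3)] p(1)
        by (intro exI[of _ "tail_balls d \<Lambda> prec x r"]) simp
    qed
    show "\<forall>x\<in>X. (INF y\<in>X. d y x) = 0"
    proof
      fix l assume l: "l \<in> X"
      obtain \<Lambda> :: "('a \<times> nat) set set" and prec x where C: "Cauchy_net X d \<Lambda> prec x"
        and lim: "limitin (smyth_topology X d) x l (net_filter \<Lambda> prec)"
        using S[unfolded smyth_continuous_def, rule_format, OF l] by (elim exE conjE)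
      have ni: "net_index \<Lambda> prec" and xX: "\<And>i. i \<in> \<Lambda> \<Longrightarrow> x i \<in> X"
        and s0: "(net_tail d \<Lambda> prec x \<longlongrightarrow> 0) (net_filter \<Lambda> prec)"
        using C by (auto simp: Cauchy_net_iff)
      have "(INF y\<in>X. d y l) \<le> 0"
      proof (rule tendsto_lowerbound[OF s0 _ net_filter_neq_bot[OF ni]])
        have "(INF y\<in>X. d y l) \<le> net_tail d \<Lambda> prec x i" if i: "i \<in> \<Lambda>" for i
          using xX[OF i] dist_limit_le_net_tail[OF C lim i] by (rule INF_lower2)
        then show "eventually (\<lambda>i. (INF y\<in>X. d y l) \<le> net_tail d \<Lambda> prec x i) (net_filter \<Lambda> prec)"
          by (rule eventually_mono[OF eventually_net_filter_mem[OF ni]])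
      qed
      then show "(INF y\<in>X. d y l) = 0" by simp
    qed
  qed
next
  assume R: "max_continuous (formal_balls X) (ball_less X d) \<and> (\<forall>x\<in>X. (INF y\<in>X. d y x) = 0)"
  show "smyth_continuous X d"
  proof (rule smyth_continuous_any_index[OF dist])
    fix l assume l: "l \<in> X"
    then obtain Y where Y: "directed_subset (formal_balls X) (ball_less X d) Y"
      and max: "is_maximum (formal_balls X) (ball_less X d) Y (l, 0)"
      using R unfolding max_continuous_def formal_balls_def by force
    have "Inf (snd ` Y) \<le> e" if e: "0 < e" for e
    proof -
      have "(INF y\<in>X. d y l) < ennreal e" using R l e by simp
      then obtain c where c: "c \<in> X" "d c l < ennreal e" by (auto simp: INF_less_iff)
      then have "ball_less X d (c, e) (l, 0)" using l by (simp add: ball_less_iff)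
      moreover have "(c, e) \<in> formal_balls X" using c e by (simp add: formal_balls_def)
      ultimately obtain p where p: "p \<in> Y" "ball_less X d (c, e) p"
        using max unfolding is_maximum_def by blast
      then have "0 < e - snd p"
        by (cases p) (auto simp: ball_less_iff dest: less_ennreal_imp_pos)
      then show ?thesis using directed_balls_Inf_less[OF dist Y p(1)] by simp
    qed
    then have "Inf (snd ` Y) \<le> 0" by (rule field_le_epsilon[of _ 0, simplified])
    with directed_balls_Inf_nonneg[OF dist Y] have "Inf (snd ` Y) = 0" by simp
    with max have "limitin (smyth_topology X d) fst l (net_filter Y (ball_less X d))"
      by (simp flip: directed_balls_maximum_iff[OF dist Y])
    with directed_balls_Cauchy_net[OF dist Y]
    show "\<exists>(\<Lambda> :: ('a \<times> real) set) prec x. Cauchy_net X d \<Lambda> prec x \<and>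
        limitin (smyth_topology X d) x l (net_filter \<Lambda> prec)" by (intro exI conjI)
  qed
qed

theorem theorem5p6:
  fixes X :: "'a set" and d :: "'a \<Rightarrow> 'a \<Rightarrow> ennreal"
  assumes "is_distance X d"
  shows "((\<forall>p\<in>formal_balls X. \<forall>q\<in>formal_balls X.
             lower_hemimetric (formal_balls X) (ball_dist d) p q =
             ball_dist (lower_hemimetric X d) p q) \<longrightarrow>
           (smyth_complete X d \<longleftrightarrow>
            max_complete (formal_balls X) (strict_order (formal_balls X) (ball_dist d)))) \<and>
         (smyth_continuous X d \<longleftrightarrow>
            max_continuous (formal_balls X) (strict_order (formal_balls X) (ball_dist d)) \<and>
            (\<forall>x\<in>X. (INF y\<in>X. d y x) = 0))"
  using smyth_complete_iff_max_complete[OF assms] smyth_continuous_iff_max_continuous[OF assms]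
  by blast

end
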